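(* The integral $$I_n=\int_{-1}^{1}\left(F_n(x)\right)^2\,\frac{dx}{1-x^2},$$ where $F_n$ is any real polynomial of degree $n$ such that $F_n(0)=1$, reaches its minimum value $$M=\frac{1}{\displaystyle\sum_{j=0}^{n}\frac{j(j-1)(2j-1)}{2}\left(\frac{(j-3)!!}{j!!}\right)^2}$$ if and only if $$F_n(x)=\frac{1}{\displaystyle\sum_{j=0}^{n}\frac{j(j-1)(2j-1)}{2}\left(\frac{(j-3)!!}{j!!}\right)^2}\;\sum_{k=0}^{n}(-1)^{\frac{k-2}{2}}\,\frac{k(k-1)(2k-1)\,(k-3)!!}{2\,k!!}\,Q_k(x),$$ i.e. $$M=\frac{1}{K_n(0,0)}\qquad\text{and}\qquad F_n(x)=\frac{K_n(x,0)}{K_n(0,0)}.$$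
   Context: The Legendre polynomials are $L_n(x)=\frac{1}{2^n n!}\frac{d^n}{dx^n}(x^2-1)^n$, normalized so that $L_n(1)=1$. The integral Legendre polynomials are $Q_k(x)=-\int_x^1 L_{k-1}(t)\,dt$ for $-1\le x\le 1$; for $k\ge 2$ they have degree $k$ and vanish at $x=\pm1$. They are orthogonal on $[-1,1]$ with respect to the weight $\frac{1}{1-x^2}$, with $\|Q_k\|^2=\int_{-1}^1\frac{Q_k(x)^2}{1-x^2}\,dx=\frac{2}{k(k-1)(2k-1)}$ for $k\ge 2$. The $n$-th kernel is $K_n(x,y)=\sum_{k=0}^{n}\frac{Q_k(x)Q_k(y)}{\|Q_k\|^2}$. In all the sums, the terms of index $0$ and $1$ are read as zero, because of the factor $k(k-1)$ (equivalently, $1/\|Q_k\|^2$ is read as $\frac{k(k-1)(2k-1)}{2}$).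
   Formalization: Corrected: sums run over even indices only (Q_k(0)=0 for odd k); the sign is (-1)^{k/2} (the printed one gives F_2(0)=-1); "degree n" means degree at most n (for odd n the minimizer has degree n-1; for even n, exactly n); n≥2 is assumed, as otherwise the sums vanish. *)

theory Defs
  imports "HOL-Analysis.Analysis" "HOL-Computational_Algebra.Polynomial"
begin

definition legendre :: "nat \<Rightarrow> real poly" where
  "legendre n = smult (1 / (2 ^ n * fact n)) ((pderiv ^^ n) ([:-1, 0, 1:] ^ n))"

text \<open>The functions \<open>Q k\<close> are meant for \<open>k \<ge> 1\<close> and arguments in \<open>[-1, 1]\<close> only; in
  particular the Henstock-Kurzweil integral over \<open>{x..1}\<close> is \<open>0\<close> for \<open>x > 1\<close>, so that \<open>Q k\<close>
  is not a polynomial function on the whole line.\<close>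

definition Q :: "nat \<Rightarrow> real \<Rightarrow> real" where
  "Q k x = - integral {x..1} (poly (legendre (k - 1)))"

definition Q_norm_sq :: "nat \<Rightarrow> real" where
  "Q_norm_sq k = integral {-1..1} (\<lambda>x. (Q k x)\<^sup>2 / (1 - x\<^sup>2))"

text \<open>The terms of index \<open>0\<close> and \<open>1\<close> are zero by convention: \<open>Q 0\<close> does not exist, and the
  weighted norm of \<open>Q 1\<close> is infinite.\<close>

definition Q_kernel :: "nat \<Rightarrow> real \<Rightarrow> real \<Rightarrow> real" where
  "Q_kernel n x y = (\<Sum>k=2..n. Q k x * Q k y / Q_norm_sq k)"

text \<open>The product is empty, hence \<open>1\<close>, for \<open>n \<le> 0\<close>; this yields the usual values
  \<open>0!! = (-1)!! = 1\<close>.\<close>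

definition double_fact :: "int \<Rightarrow> int" where
  "double_fact n = \<Prod>{i \<in> {1..n}. even (n - i)}"

text \<open>Sums containing the numbers \<open>Q k 0\<close> run over even indices only: for odd \<open>k \<ge> 3\<close> the
  function \<open>Q k\<close> is odd, so \<open>Q k 0 = 0\<close>, whereas
  \<open>Q k 0 = (-1) ^ (k div 2) * (k - 3)!! / k!!\<close> for even \<open>k \<ge> 2\<close>.
  The terms of index \<open>0\<close> vanish because of the factor \<open>k\<close>.\<close>

definition dfact_sum :: "nat \<Rightarrow> real" where
  "dfact_sum n = (\<Sum>j | j \<le> n \<and> even j.
     real j * (real j - 1) * (2 * real j - 1) / 2 *
     (real_of_int (double_fact (int j - 3)) / real_of_int (double_fact (int j)))\<^sup>2)"

definition extremal :: "nat \<Rightarrow> real \<Rightarrow> real" where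
  "extremal n x = 1 / dfact_sum n * (\<Sum>k | k \<le> n \<and> even k.
     (-1) ^ (k div 2) *
     (real k * (real k - 1) * (2 * real k - 1) * real_of_int (double_fact (int k - 3)) /
       (2 * real_of_int (double_fact (int k)))) * Q k x)"

text \<open>The integral diverges unless \<open>F\<close> vanishes at \<open>-1\<close> and \<open>1\<close>; its value is then \<open>\<infinity>\<close>.\<close>

definition weighted_integral :: "real poly \<Rightarrow> ennreal" where
  "weighted_integral F = (\<integral>\<^sup>+x\<in>{-1..1}. ennreal ((poly F x)\<^sup>2 / (1 - x\<^sup>2)) \<partial>lborel)"

definition admissible :: "nat \<Rightarrow> real poly \<Rightarrow> bool" where
  "admissible n F \<longleftrightarrow> degree F \<le> n \<and> poly F 0 = 1"

end

theory Submission
  imports Defs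
begin

text \<open>The integral is infinite unless \<open>F = (1 - x\<^sup>2) A\<close>, and then it equals
  \<open>wip A A = \<integral> (1 - x\<^sup>2) A\<^sup>2\<close>. By the Legendre differential equation
  \<open>Q\<^sub>k = (1 - x\<^sup>2) R\<^sub>k\<close> with \<open>R\<^sub>k = - L\<^sub>k\<^sub>-\<^sub>1' / (k (k - 1))\<close>, and the \<open>R\<^sub>k\<close>, \<open>2 \<le> k \<le> n\<close>, are an
  orthogonal basis of the polynomials of degree at most \<open>n - 2\<close>. Hence
  \<open>E = \<Sum> R\<^sub>k(0) R\<^sub>k / \<parallel>R\<^sub>k\<parallel>\<^sup>2\<close> reproduces values at \<open>0\<close>: \<open>wip A E = A(0)\<close>. If \<open>A(0) = 1\<close>,
  expanding the square gives \<open>wip A A = 1 / E(0) + wip D D\<close> with \<open>D = A - E / E(0)\<close>, so the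
  minimum is \<open>1 / E(0)\<close>, attained only at \<open>A = E / E(0)\<close>. The double factorials come from
  \<open>R\<^sub>k(0)\<close>, which is read off the coefficient of \<open>x\<^sup>k\<close> in \<open>(x\<^sup>2 - 1) ^ (k - 1)\<close>.\<close>

section \<open>Polynomial preliminaries\<close>

lemma poly_eqI_interval:
  fixes p q :: "real poly"
  assumes "a < b" and "\<And>x. x \<in> {a..b} \<Longrightarrow> poly p x = poly q x"
  shows "p = q"
proof -
  have "infinite {a..b}" using assms(1) by (simp add: infinite_Icc)
  moreover have "{a..b} \<subseteq> {x. poly (p - q) x = 0}" using assms(2) by auto
  ultimately have "infinite {x. poly (p - q) x = 0}" by (meson finite_subset)
  then show ?thesis using poly_roots_finite[of "p - q"] by auto
qed

text \<open>Subtracting a multiple of \<open>B n\<close> cancels the coefficient of degree n;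
  iterate downwards. It serves both the Legendre polynomials and the shifted cofactors.\<close>

lemma poly_span_graded:
  fixes B :: "nat \<Rightarrow> 'a::field poly"
  assumes B: "\<And>j. degree (B j) = j" "\<And>j. B j \<noteq> 0" and p: "degree p \<le> n"
  shows "\<exists>c. p = (\<Sum>j\<le>n. smult (c j) (B j))"
  using p
proof (induction n arbitrary: p)
  case 0
  have B0: "B 0 = [:coeff (B 0) 0:]" "coeff (B 0) 0 \<noteq> 0"
    using B[of 0] by (auto elim: degree_eq_zeroE)
  have "p = [:coeff p 0:]" using 0 by (auto elim: degree_eq_zeroE)
  then have "p = smult (coeff p 0 / coeff (B 0) 0) (B 0)"
    using B0 by (metis nonzero_divide_eq_eq smult_0_right smult_pCons)
  then show ?case by (intro exI[of _ "\<lambda>_. coeff p 0 / coeff (B 0) 0"]) simp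
next
  case (Suc n)
  define a where "a = coeff p (Suc n) / coeff (B (Suc n)) (Suc n)"
  define q where "q = p - smult a (B (Suc n))"
  have nz: "coeff (B (Suc n)) (Suc n) \<noteq> 0"
    using B[of "Suc n"] leading_coeff_0_iff by metis
  have "coeff q i = 0" if "i > n" for i
  proof (cases "i = Suc n")
    case True then show ?thesis using nz by (simp add: q_def a_def)
  next
    case False then show ?thesis using that Suc.prems B(1)[of "Suc n"]
      by (simp add: q_def coeff_eq_0)
  qed
  then have "degree q \<le> n" by (simp add: degree_le)
  from Suc.IH[OF this] obtain c where c: "q = (\<Sum>j\<le>n. smult (c j) (B j))" by blast
  have "p = (\<Sum>j\<le>Suc n. smult ((c(Suc n := a)) j) (B j))"
    using c by (simp add: q_def algebra_simps)
  then show ?case by blast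
qed

text \<open>By Leibniz, only the term in which all n derivatives hit the power survives at a. With
  the Rodrigues formula this gives the endpoint values of \<open>legendre n\<close>.\<close>

lemma poly_higher_pderiv_power_mult:
  fixes q :: "'a::field_char_0 poly"
  shows "poly ((pderiv ^^ n) ([:-a, 1:] ^ n * q)) a = fact n * poly q a"
proof (induction n arbitrary: q)
  case 0 then show ?case by simp
next
  case (Suc n)
  have "pderiv ([:-a, 1:] ^ Suc n * q) =
      [:-a, 1:] ^ n * (smult (of_nat (Suc n)) q + [:-a, 1:] * pderiv q)"
    by (simp only: pderiv_mult pderiv_power_Suc) (simp add: pderiv_pCons algebra_simps)
  then have "(pderiv ^^ Suc n) ([:-a, 1:] ^ Suc n * q) =
      (pderiv ^^ n) ([:-a, 1:] ^ n * (smult (of_nat (Suc n)) q + [:-a, 1:] * pderiv q))"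
    by (simp only: funpow_Suc_right o_apply)
  then have "poly ((pderiv ^^ Suc n) ([:-a, 1:] ^ Suc n * q)) a =
      fact n * poly (smult (of_nat (Suc n)) q + [:-a, 1:] * pderiv q) a"
    by (simp only: Suc.IH)
  then show ?case by (simp add: algebra_simps)
qed

section \<open>Legendre polynomials\<close>

lemma degree_legendre: "degree (legendre n) = n"
  by (simp add: legendre_def degree_higher_pderiv degree_power_eq)

lemma legendre_nz: "legendre n \<noteq> 0"
proof (cases n)
  case 0 then show ?thesis by (simp add: legendre_def)
next
  case (Suc m) then show ?thesis using degree_legendre[of n] by auto
qed

lemma legendre_at_1: "poly (legendre n) 1 = 1"
proof -
  have "[:-1, 0, 1:] ^ n = [:-1, 1:] ^ n * ([:1, 1:] ^ n :: real poly)"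
    by (simp flip: power_mult_distrib)
  then show ?thesis using poly_higher_pderiv_power_mult[of n 1 "[:1, 1::real:] ^ n"]
    by (simp add: legendre_def poly_power)
qed

lemma legendre_at_minus_1: "poly (legendre n) (-1) = (-1) ^ n"
proof -
  have "[:-1, 0, 1:] ^ n = [:1, 1:] ^ n * ([:-1, 1:] ^ n :: real poly)"
    by (simp flip: power_mult_distrib)
  then show ?thesis using poly_higher_pderiv_power_mult[of n "-1" "[:-1, 1::real:] ^ n"]
    by (simp add: legendre_def poly_power power_minus[of 2])
qed

text \<open>Differentiate \<open>(x\<^sup>2 - 1) w' = 2 n x w\<close>, where \<open>w = (x\<^sup>2 - 1) ^ n\<close>, \<open>k + 1\<close> times.\<close>

lemma higher_pderiv_ode:
  fixes n k :: nat
  defines "w \<equiv> ([:-1, 0, 1:] :: real poly) ^ n"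
  shows "[:-1, 0, 1:] * (pderiv ^^ (k + 2)) w
      + smult (2 * (real k + 1) - 2 * real n) ([:0, 1:] * (pderiv ^^ (k + 1)) w)
      + smult ((real k + 1) * (real k - 2 * real n)) ((pderiv ^^ k) w) = 0"
proof (induction k)
  case 0
  have "[:-1, 0, 1:] * pderiv w = smult (2 * real n) ([:0, 1:] * w)"
  proof (cases n)
    case (Suc m)
    have "pderiv w = smult (real (Suc m)) ([:-1, 0, 1:] ^ m) * pderiv [:-1, 0, 1:]"
      by (simp only: w_def Suc pderiv_power_Suc)
    then show ?thesis
      by (simp add: w_def Suc pderiv_pCons poly_eq_poly_eq_iff[symmetric] fun_eq_iff algebra_simps)
  qed (simp add: w_def)
  then have "pderiv ([:-1, 0, 1:] * pderiv w) = pderiv (smult (2 * real n) ([:0, 1:] * w))"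
    by simp
  then show ?case
    by (simp add: pderiv_mult pderiv_pCons pderiv_smult pderiv_add pderiv_diff pderiv_minus
        poly_eq_poly_eq_iff[symmetric] fun_eq_iff algebra_simps)
next
  case (Suc k)
  have "pderiv ([:-1, 0, 1:] * (pderiv ^^ (k + 2)) w
      + smult (2 * (real k + 1) - 2 * real n) ([:0, 1:] * (pderiv ^^ (k + 1)) w)
      + smult ((real k + 1) * (real k - 2 * real n)) ((pderiv ^^ k) w)) = 0"
    using Suc by simp
  then show ?case
    by (simp add: pderiv_mult pderiv_add pderiv_diff pderiv_pCons pderiv_smult
        poly_eq_poly_eq_iff[symmetric] fun_eq_iff algebra_simps)
qed

text \<open>The case k = n of \<open>higher_pderiv_ode\<close>, put in self-adjoint form for
  integration by parts.\<close>

lemma legendre_ode: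
  "pderiv ([:1, 0, -1:] * pderiv (legendre n)) = smult (- (real n * (real n + 1))) (legendre n)"
proof -
  define v where "v = (pderiv ^^ n) (([:-1, 0, 1:] :: real poly) ^ n)"
  have "[:-1, 0, 1:] * pderiv (pderiv v) + smult 2 ([:0, 1:] * pderiv v)
      + smult (- (real n + 1) * real n) v = 0"
    using higher_pderiv_ode[of n n] by (simp add: v_def algebra_simps)
  then have *: "pderiv ([:1, 0, -1:] * pderiv v) = smult (- (real n * (real n + 1))) v"
    by (simp add: pderiv_mult pderiv_pCons pderiv_add pderiv_diff pderiv_minus
        poly_eq_poly_eq_iff[symmetric] fun_eq_iff algebra_simps)
  have "legendre n = smult (1 / (2 ^ n * fact n)) v" by (simp add: legendre_def v_def)
  then show ?thesis using * by (simp add: pderiv_smult mult.commute)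
qed

section \<open>Polynomial integrals and orthogonality of the Legendre polynomials\<close>

lemma poly_integrable: "poly (p :: real poly) integrable_on {a..b}"
  by (intro integrable_continuous_interval continuous_intros)

lemma integral_pderiv:
  fixes p :: "real poly"
  assumes "a \<le> b"
  shows "integral {a..b} (poly (pderiv p)) = poly p b - poly p a"
  by (intro integral_unique fundamental_theorem_of_calculus assms)
    (auto simp: has_real_derivative_iff_has_vector_derivative[symmetric]
      intro: DERIV_subset[OF poly_DERIV])

lemma integral_poly_add:
  "integral {a..b} (poly (p + q)) = integral {a..b} (poly p) + integral {a..b} (poly (q :: real poly))"
  by (simp add: integral_add poly_integrable fun_eq_iff poly_add[abs_def])

lemma integral_poly_smult:
  "integral {a..b} (poly (smult c p)) = c * integral {a..b} (poly (p :: real poly))"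
  by (simp add: poly_smult[abs_def])

lemma integral_poly_diff:
  "integral {a..b} (poly (p - q)) = integral {a..b} (poly p) - integral {a..b} (poly (q :: real poly))"
  using integral_poly_add[of a b "p - q" q] by simp

lemma integral_poly_sum:
  "integral {a..b} (poly (\<Sum>i\<in>I. f i)) = (\<Sum>i\<in>I. integral {a..b} (poly (f i :: real poly)))"
proof (induction I rule: infinite_finite_induct)
  case (insert i I)
  show ?case by (simp only: sum.insert[OF insert.hyps] integral_poly_add insert.IH)
qed (simp_all add: poly_0[abs_def])

text \<open>The product with weight 1/(1 - x^2) of (1 - x^2) A and (1 - x^2) B; cancelling the
  weight leaves a polynomial integrand.\<close>

definition wip :: "real poly \<Rightarrow> real poly \<Rightarrow> real" where
  "wip A B = integral {-1..1} (poly ([:1, 0, -1:] * A * B))"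

text \<open>Integration by parts: the factor 1 - x^2 kills the boundary terms, and the differential
  equation supplies the eigenvalue i (i + 1).\<close>

lemma wip_legendre:
  "wip (pderiv (legendre i)) (pderiv (legendre j)) =
    real i * (real i + 1) * integral {-1..1} (poly (legendre i * legendre j))"
proof -
  have "pderiv ([:1, 0, -1:] * pderiv (legendre i) * legendre j) =
      [:1, 0, -1:] * pderiv (legendre i) * pderiv (legendre j)
      + smult (- (real i * (real i + 1))) (legendre i * legendre j)"
    by (subst pderiv_mult, subst legendre_ode) (simp add: algebra_simps)
  then have "integral {-1..1} (poly ([:1, 0, -1:] * pderiv (legendre i) * pderiv (legendre j)
      + smult (- (real i * (real i + 1))) (legendre i * legendre j))) = 0"
    using integral_pderiv[of "-1" 1 "[:1, 0, -1:] * pderiv (legendre i) * legendre j"] by simp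
  then show ?thesis by (simp only: integral_poly_add integral_poly_smult wip_def) simp
qed

lemma wip_commute: "wip A B = wip B A"
  by (simp only: wip_def mult.assoc mult.left_commute mult.commute)

text \<open>\<open>wip\<close> is symmetric, but \<open>wip_legendre\<close> carries the eigenvalue
  of its first index only; swapping i and j gives two different multiples of one integral.\<close>

lemma legendre_orthogonal:
  assumes "i \<noteq> j"
  shows "integral {-1..1} (poly (legendre i * legendre j)) = 0"
proof -
  have "(real i * (real i + 1) - real j * (real j + 1)) *
      integral {-1..1} (poly (legendre i * legendre j)) = 0"
    using wip_legendre[of i j] wip_legendre[of j i]
    by (simp add: wip_commute mult.commute[of "legendre j"] algebra_simps)
  moreover have "real i * (real i + 1) - real j * (real j + 1) = (real i - real j) * (real i + real j + 1)"
    by (simp add: algebra_simps)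
  ultimately show ?thesis using assms by auto
qed

text \<open>Integrate \<open>(x L\<^sub>m\<^sup>2)'\<close> and use that \<open>x L\<^sub>m' - m L\<^sub>m\<close> has degree less than \<open>m\<close>.\<close>

lemma legendre_norm: "integral {-1..1} (poly (legendre m * legendre m)) = 2 / (2 * real m + 1)"
proof (cases m)
  case 0
  then have "legendre m * legendre m = 1" by (simp add: legendre_def)
  then show ?thesis using 0 by (simp add: poly_1[abs_def])
next
  case (Suc l)
  define L where "L = legendre m"
  define r where "r = [:0, 1:] * pderiv L - smult (real m) L"
  \<comment> \<open>The operator x d/dx multiplies the coefficient of x^i by i, so r loses its term
    of degree m.\<close>
  have "coeff r i = 0" if "i > l" for i
  proof -
    have "coeff r i = (real i - real m) * coeff L i" using that
      by (cases i) (simp_all add: r_def coeff_pderiv algebra_simps)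
    then show ?thesis using that Suc degree_legendre[of m]
      by (cases "i = m") (simp_all add: L_def coeff_eq_0)
  qed
  then have "degree r \<le> l" by (simp add: degree_le)
  from poly_span_graded[OF degree_legendre legendre_nz this]
  obtain c where c: "r = (\<Sum>j\<le>l. smult (c j) (legendre j))" by blast
  have "L * r = (\<Sum>j\<le>l. smult (c j) (legendre m * legendre j))"
    by (simp add: c sum_distrib_left L_def)
  then have r0: "integral {-1..1} (poly (L * r)) = 0"
    using Suc by (simp add: integral_poly_sum integral_poly_smult legendre_orthogonal)
  have "pderiv ([:0, 1:] * (L * L)) = smult (2 * real m + 1) (L * L) + smult 2 (L * r)"
    by (simp add: r_def pderiv_mult pderiv_pCons poly_eq_poly_eq_iff[symmetric] fun_eq_iff
        algebra_simps)
  then have "integral {-1..1} (poly (smult (2 * real m + 1) (L * L) + smult 2 (L * r))) =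
      poly ([:0, 1:] * (L * L)) 1 - poly ([:0, 1:] * (L * L)) (-1)"
    using integral_pderiv[of "-1" 1 "[:0, 1:] * (L * L)"] by simp
  also have "\<dots> = 2"
    by (simp add: L_def legendre_at_1 legendre_at_minus_1 flip: power_mult_distrib)
  finally have "(2 * real m + 1) * integral {-1..1} (poly (L * L)) = 2"
    by (simp only: integral_poly_add integral_poly_smult r0 mult_zero_right add_0_right)
  then show ?thesis by (simp add: L_def field_simps)
qed


lemma wip_smult_left: "wip (smult a A) B = a * wip A B"
proof -
  have "[:1, 0, -1:] * smult a A * B = smult a ([:1, 0, -1:] * A * B)"
    by (simp only: mult_smult_left mult_smult_right)
  then show ?thesis by (simp only: wip_def integral_poly_smult)
qed

lemma wip_smult_right: "wip A (smult b B) = b * wip A B"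
  using wip_smult_left[of b B A] by (simp add: wip_commute)

lemma wip_diff_left: "wip (A - B) C = wip A C - wip B C"
  by (simp only: wip_def right_diff_distrib left_diff_distrib integral_poly_diff)

lemma wip_diff_right: "wip C (A - B) = wip C A - wip C B"
  using wip_diff_left[of A B C] by (simp add: wip_commute)

lemma wip_sum_left: "wip (\<Sum>i\<in>I. f i) B = (\<Sum>i\<in>I. wip (f i) B)"
  by (simp only: wip_def sum_distrib_left sum_distrib_right integral_poly_sum)

lemma wip_sum_right: "wip A (\<Sum>i\<in>I. f i) = (\<Sum>i\<in>I. wip A (f i))"
  using wip_sum_left[of f I A] by (simp add: wip_commute)

section \<open>Integral Legendre polynomials\<close>

text \<open>This is \<open>R\<^sub>k\<close>; for k < 2 the division by zero makes it the zero
  polynomial.\<close>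

definition Q_cofactor :: "nat \<Rightarrow> real poly" where
  "Q_cofactor k = smult (- 1 / (real k * (real k - 1))) (pderiv (legendre (k - 1)))"

text \<open>The reciprocal of the squared norm of \<open>Q k\<close> for k >= 2, in the closed form
  that also vanishes at 0 and 1.\<close>

definition Q_weight :: "nat \<Rightarrow> real" where
  "Q_weight k = real k * (real k - 1) * (2 * real k - 1) / 2"

lemma Q_weight_pos: "k \<ge> 2 \<Longrightarrow> Q_weight k > 0"
  by (simp add: Q_weight_def)

lemma degree_Q_cofactor: "k \<ge> 2 \<Longrightarrow> degree (Q_cofactor k) = k - 2"
  by (simp add: Q_cofactor_def degree_pderiv degree_legendre)

lemma Q_cofactor_nz: "k \<ge> 2 \<Longrightarrow> Q_cofactor k \<noteq> 0"
  by (simp add: Q_cofactor_def pderiv_eq_0_iff degree_legendre)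

lemma pderiv_Q_cofactor:
  assumes "k \<ge> 2"
  shows "pderiv ([:1, 0, -1:] * Q_cofactor k) = legendre (k - 1)"
proof -
  have "[:1, 0, -1:] * Q_cofactor k =
      smult (- 1 / (real k * (real k - 1))) ([:1, 0, -1:] * pderiv (legendre (k - 1)))"
    by (simp only: Q_cofactor_def mult_smult_right)
  then have "pderiv ([:1, 0, -1:] * Q_cofactor k) = smult (- 1 / (real k * (real k - 1)))
      (smult (- (real (k - 1) * (real (k - 1) + 1))) (legendre (k - 1)))"
    by (simp only: pderiv_smult legendre_ode)
  then show ?thesis using assms by (simp add: of_nat_diff)
qed

text \<open>The right side is an antiderivative of \<open>legendre (k - 1)\<close> that vanishes at
  1. For x > 1 the integral in \<open>Q\<close> is over an empty interval, hence the bound on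
  x.\<close>

lemma Q_eq_cofactor:
  assumes "k \<ge> 2" "x \<le> 1"
  shows "Q k x = (1 - x\<^sup>2) * poly (Q_cofactor k) x"
  using integral_pderiv[OF assms(2), of "[:1, 0, -1:] * Q_cofactor k"]
  unfolding pderiv_Q_cofactor[OF assms(1)]
  by (simp add: Q_def power2_eq_square algebra_simps)

lemma wip_Q_cofactor:
  assumes "j \<ge> 2" "k \<ge> 2"
  shows "wip (Q_cofactor j) (Q_cofactor k) = (if j = k then 1 / Q_weight k else 0)"
proof (cases "j = k")
  case True
  have "wip (Q_cofactor k) (Q_cofactor k) = (- 1 / (real k * (real k - 1)))\<^sup>2 *
      ((real k - 1) * real k * (2 / (2 * real k - 1)))"
    unfolding Q_cofactor_def wip_smult_left wip_smult_right wip_legendre legendre_norm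
    using assms by (simp add: of_nat_diff power2_eq_square)
  also have "\<dots> = 1 / Q_weight k"
  proof -
    have "real k \<noteq> 0" "real k - 1 \<noteq> 0" "2 * real k - 1 \<noteq> 0" using assms by auto
    then show ?thesis by (simp add: Q_weight_def power2_eq_square divide_simps)
  qed
  finally show ?thesis using True by simp
next
  case False
  then have "j - 1 \<noteq> k - 1" using assms by linarith
  then show ?thesis using False
    unfolding Q_cofactor_def wip_smult_left wip_smult_right wip_legendre
    by (simp add: legendre_orthogonal)
qed

lemma Q_norm_sq_eq:
  assumes "k \<ge> 2"
  shows "Q_norm_sq k = 1 / Q_weight k"
proof -
  \<comment> \<open>At the endpoints the quotient is 0 by the convention for division by zero, and
    so is the polynomial.\<close>
  have "(Q k x)\<^sup>2 / (1 - x\<^sup>2) = poly ([:1, 0, -1:] * Q_cofactor k * Q_cofactor k) x"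
    if "x \<in> {-1..1}" for x
    using that by (cases "1 - x\<^sup>2 = 0")
      (simp_all add: Q_eq_cofactor[OF assms] power2_eq_square field_simps)
  then have "Q_norm_sq k = wip (Q_cofactor k) (Q_cofactor k)"
    unfolding Q_norm_sq_def wip_def by (rule integral_cong)
  then show ?thesis using assms by (simp add: wip_Q_cofactor)
qed

lemma Q_cofactor_span:
  assumes "n \<ge> 2" "degree A \<le> n - 2"
  shows "\<exists>c. A = (\<Sum>k=2..n. smult (c k) (Q_cofactor k))"
proof -
  obtain c where "A = (\<Sum>j\<le>n - 2. smult (c j) (Q_cofactor (j + 2)))"
    using poly_span_graded[of "\<lambda>j. Q_cofactor (j + 2)" A "n - 2"] assms(2)
    by (auto simp: degree_Q_cofactor Q_cofactor_nz)
  also have "\<dots> = (\<Sum>k=0 + 2..n - 2 + 2. smult (c (k - 2)) (Q_cofactor k))"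
    by (simp only: sum.shift_bounds_cl_nat_ivl atLeast0AtMost) simp
  also have "\<dots> = (\<Sum>k=2..n. smult (c (k - 2)) (Q_cofactor k))"
    using assms(1) by (simp only: le_add_diff_inverse2 add_0)
  finally show ?thesis by (intro exI[of _ "\<lambda>k. c (k - 2)"])
qed

section \<open>The reproducing kernel at the origin\<close>

text \<open>The polynomial E of the overview; (1 - x^2) times it is K_n(x, 0) on [-1, 1].\<close>

definition kernel_poly :: "nat \<Rightarrow> real poly" where
  "kernel_poly n = (\<Sum>k=2..n. smult (poly (Q_cofactor k) 0 * Q_weight k) (Q_cofactor k))"

text \<open>By linearity it suffices to test A = R_k: orthogonality keeps one term, in which
  \<open>Q_weight k\<close> cancels the squared norm of R_k.\<close>

lemma kernel_poly_reproducing: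
  assumes "n \<ge> 2" "degree A \<le> n - 2"
  shows "wip A (kernel_poly n) = poly A 0"
proof -
  obtain c where c: "A = (\<Sum>k=2..n. smult (c k) (Q_cofactor k))"
    using Q_cofactor_span[OF assms] by blast
  have "wip (Q_cofactor k) (kernel_poly n) = poly (Q_cofactor k) 0" if "k \<in> {2..n}" for k
  proof -
    have "wip (Q_cofactor k) (kernel_poly n) =
        (\<Sum>j=2..n. if k = j then poly (Q_cofactor j) 0 else 0)"
      unfolding kernel_poly_def wip_sum_right wip_smult_right using that
      by (intro sum.cong) (auto simp: wip_Q_cofactor Q_weight_pos less_imp_neq[symmetric])
    then show ?thesis using that by simp
  qed
  then show ?thesis
    unfolding c wip_sum_left wip_smult_left by (simp add: poly_sum)
qed

text \<open>In the orthogonal basis \<open>wip A A\<close> is a sum of squares with positive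
  weights, and some coefficient of a nonzero A is nonzero.\<close>

lemma wip_self_pos:
  assumes "A \<noteq> 0"
  shows "wip A A > 0"
proof -
  have n: "degree A \<le> (degree A + 2) - 2" "degree A + 2 \<ge> 2" by simp_all
  obtain c where c: "A = (\<Sum>k=2..degree A + 2. smult (c k) (Q_cofactor k))"
    using Q_cofactor_span[OF n(2,1)] by blast
  define n where "n = degree A + 2"
  have c: "A = (\<Sum>k=2..n. smult (c k) (Q_cofactor k))" using c by (simp add: n_def)
  have "wip A A = (\<Sum>k=2..n. c k * (\<Sum>j=2..n. if k = j then c j / Q_weight j else 0))"
    unfolding c wip_sum_left wip_smult_left wip_sum_right wip_smult_right
    by (intro sum.cong arg_cong2[of _ _ _ _ "(*)"]) (auto simp: wip_Q_cofactor)
  also have "\<dots> = (\<Sum>k=2..n. (c k)\<^sup>2 / Q_weight k)"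
    by (intro sum.cong) (auto simp: power2_eq_square)
  also have "\<dots> > 0"
  proof -
    obtain k where "k \<in> {2..n}" "c k \<noteq> 0"
      using c assms by (metis (no_types, lifting) smult_0_left sum.neutral)
    then show ?thesis using Q_weight_pos
      by (intro sum_pos2[of _ k]) (auto intro!: divide_nonneg_pos)
  qed
  finally show ?thesis .
qed

section \<open>Values at the origin\<close>

lemma coeff_square_minus_one_power:
  "coeff ([:-1, 0, 1:] ^ n :: real poly) (2 * i) = (-1) ^ (n + i) * real (n choose i)"
  "coeff ([:-1, 0, 1:] ^ n :: real poly) (2 * i + 1) = 0"
proof (induction n arbitrary: i)
  case 0
  case 1 show ?case by (cases i) (simp_all add: coeff_1)
  case 2 show ?case by (simp add: coeff_1)
next
  case (Suc n)
  \<comment> \<open>Multiplication by x^2 shifts coefficients by two, so the recursion becomes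
    Pascal's rule with signs.\<close>
  have *: "[:-1, 0, 1:] ^ Suc n = pCons 0 (pCons 0 ([:-1, 0, 1:] ^ n)) - ([:-1, 0, 1:] ^ n :: real poly)"
    by simp
  case 1 show ?case unfolding * using Suc.IH(1)[of i] Suc.IH(1)[of "i - 1"]
    by (cases i) (auto simp: coeff_pCons algebra_simps)
  case 2 show ?case unfolding * using Suc.IH(2)[of i] Suc.IH(2)[of "i - 1"]
    by (cases i) (auto simp: coeff_pCons)
qed

text \<open>The bound is sharp: for n = -2 the left side is 0!! = 1 and the right side is 0.\<close>

lemma double_fact_rec:
  assumes "n \<ge> -1"
  shows "double_fact (n + 2) = (n + 2) * double_fact n"
proof -
  have "{i \<in> {1..n + 2}. even (n + 2 - i)} = insert (n + 2) {i \<in> {1..n}. even (n - i)}"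
    using assms by (auto; presburger)
  moreover have "finite {i \<in> {1..n}. even (n - i)}"
    by (rule finite_subset[of _ "{1..n}"]) auto
  ultimately show ?thesis by (simp add: double_fact_def)
qed

lemma double_fact_even: "double_fact (2 * int j) = 2 ^ j * fact j"
proof (induction j)
  case (Suc j)
  then show ?case using double_fact_rec[of "2 * int j"] by (simp add: algebra_simps)
qed (simp add: double_fact_def)

text \<open>This is (2j - 1)!! (2j)!! = (2j)!, kept free of division because
  \<open>double_fact\<close> is integral.\<close>

lemma double_fact_odd: "double_fact (2 * int j - 1) * (2 ^ j * fact j) = fact (2 * j)"
proof (induction j)
  case (Suc j)
  have "double_fact (2 * int (Suc j) - 1) = (2 * int j + 1) * double_fact (2 * int j - 1)"
    using double_fact_rec[of "2 * int j - 1"] by (simp add: algebra_simps)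
  then have "double_fact (2 * int (Suc j) - 1) * (2 ^ Suc j * fact (Suc j)) =
      (2 * int j + 1) * (2 * int j + 2) * (double_fact (2 * int j - 1) * (2 ^ j * fact j))"
    by (simp add: algebra_simps)
  also have "\<dots> = fact (2 * Suc j)"
    unfolding Suc by (simp add: algebra_simps)
  finally show ?case .
qed (simp add: double_fact_def)

text \<open>By Rodrigues, the derivative of \<open>legendre (k - 1)\<close> is a k-th derivative,
  whose value at 0 is k! times the coefficient of x^k; then k!/(k - 1)! = k cancels.\<close>

lemma Q_cofactor_at_0:
  assumes "k \<ge> 2"
  shows "poly (Q_cofactor k) 0 = - coeff ([:-1, 0, 1:] ^ (k - 1)) k / ((real k - 1) * 2 ^ (k - 1))"
proof -
  obtain m where m: "k = Suc m" "m \<ge> 1" using assms by (cases k) auto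
  have "poly (pderiv (legendre m)) 0 =
      1 / (2 ^ m * fact m) * coeff ((pderiv ^^ Suc m) ([:-1, 0, 1:] ^ m)) 0"
    by (simp add: legendre_def pderiv_smult poly_0_coeff_0)
  also have "\<dots> = 1 / (2 ^ m * fact m) * (fact (Suc m) * coeff ([:-1, 0, 1:] ^ m) (Suc m))"
    by (simp only: coeff_higher_pderiv pochhammer_fact) simp
  also have "\<dots> = real k * coeff ([:-1, 0, 1:] ^ m) k / 2 ^ m"
    using m by simp
  finally show ?thesis using m by (simp add: Q_cofactor_def)
qed

lemma Q_cofactor_at_0_odd:
  assumes "k \<ge> 2" "odd k"
  shows "poly (Q_cofactor k) 0 = 0"
proof -
  from assms(2) obtain i where "k = 2 * i + 1" by (rule oddE)
  then show ?thesis
    unfolding Q_cofactor_at_0[OF assms(1)] using coeff_square_minus_one_power(2)[of "k - 1" i] by simp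
qed

lemma Q_cofactor_at_0_even:
  assumes "k \<ge> 2" "even k"
  shows "poly (Q_cofactor k) 0 =
    (-1) ^ (k div 2) * real_of_int (double_fact (int k - 3)) / real_of_int (double_fact (int k))"
proof -
  obtain j where k: "k = 2 * Suc j"
    using assms by (metis One_nat_def Suc_pred' dvd_div_eq_0_iff dvd_mult_div_cancel
        gr0I mult_zero_right not_numeral_le_zero)
  have c: "real ((2 * j + 1) choose (j + 1)) = (2 * real j + 1) * fact (2 * j) / (fact j * fact (Suc j))"
    by (subst binomial_fact) (simp_all add: field_simps)
  have e: "real_of_int (double_fact (int k)) = 2 ^ Suc j * fact (Suc j)"
    using double_fact_even[of "Suc j"] by (simp add: k)
  have "real_of_int (double_fact (2 * int j - 1)) * (2 ^ j * fact j) = fact (2 * j)"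
    using double_fact_odd[of j]
    by (metis of_int_fact of_int_mult of_int_numeral of_int_power)
  moreover have "int k - 3 = 2 * int j - 1" using k by simp
  ultimately have o: "real_of_int (double_fact (int k - 3)) = fact (2 * j) / (2 ^ j * fact j)"
    by (simp add: field_simps)
  have k1: "k - 1 = 2 * j + 1" "real k - 1 = 2 * real j + 1" by (simp_all add: k)
  \<comment> \<open>The odd power k - 1 contributes a minus sign, which cancels the one in
    \<open>Q_cofactor_at_0\<close>.\<close>
  have "(-1) ^ (2 * j + 1 + Suc j) = - ((-1) ^ Suc j :: real)"
    by (simp only: power_add power_one_right power_minus1_even mult_1_left mult_minus_left)
  then have "coeff ([:-1, 0, 1:] ^ (2 * j + 1) :: real poly) k =
      - ((-1) ^ Suc j * real ((2 * j + 1) choose (j + 1)))"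
    using coeff_square_minus_one_power(1)[of "2 * j + 1" "Suc j"]
    unfolding k Suc_eq_plus1 by simp
  then have "poly (Q_cofactor k) 0 = (-1) ^ Suc j * real ((2 * j + 1) choose (j + 1)) /
      ((2 * real j + 1) * 2 ^ (2 * j + 1))"
    by (simp only: Q_cofactor_at_0[OF assms(1)] k1 minus_minus)
  also have "\<dots> = (-1) ^ Suc j * (fact (2 * j) / (fact j * fact (Suc j) * 2 ^ (2 * j + 1)))"
    unfolding c by (simp del: fact_Suc power_Suc)
  also have "\<dots> = (-1) ^ Suc j * (fact (2 * j) / (2 ^ j * fact j)) / (2 ^ Suc j * fact (Suc j))"
  proof -
    \<comment> \<open>Of these powers of two, j belong to (k - 3)!! and j + 1 to k!!.\<close>
    have "2 * j + 1 = j + Suc j" by simp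
    then have pow: "(2::real) ^ (2 * j + 1) = 2 ^ j * 2 ^ Suc j" by (simp only: power_add)
    have "s * (f / (a * b * (p * q))) = s * (f / (p * a)) / (q * b)" for s f a b p q :: real
      by (simp add: mult_ac)
    then show ?thesis unfolding pow .
  qed
  also have "\<dots> = (-1) ^ (k div 2) * real_of_int (double_fact (int k - 3)) / real_of_int (double_fact (int k))"
    unfolding e o by (simp add: k)
  finally show ?thesis .
qed

lemma double_fact_pos: "double_fact n > 0"
  unfolding double_fact_def by (rule prod_pos) auto

lemma Q_cofactor_at_0_nz:
  assumes "k \<ge> 2" "even k"
  shows "poly (Q_cofactor k) 0 \<noteq> 0"
  using double_fact_pos[of "int k"] double_fact_pos[of "int k - 3"]
  by (simp add: Q_cofactor_at_0_even[OF assms])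

text \<open>Bridges the even-index sums with double factorials and the kernel sums over
  2..n.\<close>

lemma sum_even_eq:
  fixes f g :: "nat \<Rightarrow> real"
  assumes "f 0 = 0" "\<And>k. k \<ge> 2 \<Longrightarrow> even k \<Longrightarrow> f k = g k" "\<And>k. k \<ge> 2 \<Longrightarrow> odd k \<Longrightarrow> g k = 0"
  shows "(\<Sum>k | k \<le> n \<and> even k. f k) = (\<Sum>k=2..n. g k)"
proof -
  have "(\<Sum>k | k \<le> n \<and> even k. f k) = (\<Sum>k | 2 \<le> k \<and> k \<le> n \<and> even k. f k)"
  proof (rule sum.mono_neutral_right)
    show "\<forall>i\<in>{k. k \<le> n \<and> even k} - {k. 2 \<le> k \<and> k \<le> n \<and> even k}. f i = 0"
    proof
      fix i assume "i \<in> {k. k \<le> n \<and> even k} - {k. 2 \<le> k \<and> k \<le> n \<and> even k}"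
      then have "i < 2" "even i" by auto
      then have "i = 0" by presburger
      then show "f i = 0" using assms(1) by simp
    qed
  qed auto
  also have "\<dots> = (\<Sum>k=2..n. g k)"
    by (rule sum.mono_neutral_cong_left) (auto simp: assms)
  finally show ?thesis .
qed

section \<open>The kernel, the double factorial sum and the extremal function through
  \<open>kernel_poly\<close>\<close>

lemma poly_kernel_poly:
  "poly (kernel_poly n) x = (\<Sum>k=2..n. poly (Q_cofactor k) 0 * Q_weight k * poly (Q_cofactor k) x)"
  by (simp add: kernel_poly_def poly_sum)

lemma dfact_sum_eq: "dfact_sum n = poly (kernel_poly n) 0"
  unfolding dfact_sum_def poly_kernel_poly
  by (rule sum_even_eq)
    (auto simp: Q_cofactor_at_0_odd Q_cofactor_at_0_even Q_weight_def power2_eq_square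
      simp flip: power_mult_distrib)

lemma Q_kernel_eq:
  assumes "x \<le> 1"
  shows "Q_kernel n x 0 = (1 - x\<^sup>2) * poly (kernel_poly n) x"
  unfolding Q_kernel_def poly_kernel_poly sum_distrib_left
  by (rule sum.cong) (auto simp: Q_eq_cofactor assms Q_norm_sq_eq)

lemma extremal_eq:
  assumes "x \<le> 1"
  shows "extremal n x = (1 - x\<^sup>2) * poly (kernel_poly n) x / poly (kernel_poly n) 0"
proof -
  have "(\<Sum>k | k \<le> n \<and> even k. (-1) ^ (k div 2) *
     (real k * (real k - 1) * (2 * real k - 1) * real_of_int (double_fact (int k - 3)) /
       (2 * real_of_int (double_fact (int k)))) * Q k x) =
     (1 - x\<^sup>2) * poly (kernel_poly n) x"
    unfolding poly_kernel_poly sum_distrib_left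
    by (rule sum_even_eq)
      (auto simp: Q_cofactor_at_0_odd Q_cofactor_at_0_even Q_weight_def Q_eq_cofactor assms)
  then show ?thesis
    by (simp add: extremal_def dfact_sum_eq)
qed

text \<open>Every term is a positive weight times R_k(0)^2, and R_2(0) is nonzero.\<close>

lemma kernel_poly_at_0_pos:
  assumes "n \<ge> 2"
  shows "poly (kernel_poly n) 0 > 0"
  unfolding poly_kernel_poly
proof (rule sum_pos2[of _ 2])
  show "0 < poly (Q_cofactor 2) 0 * Q_weight 2 * poly (Q_cofactor 2) 0"
    using Q_cofactor_at_0_nz[of 2] Q_weight_pos[of 2]
    by (auto simp: zero_less_mult_iff mult_less_0_iff)
  fix k assume "k \<in> {2..n}"
  then have "Q_weight k * (poly (Q_cofactor k) 0)\<^sup>2 \<ge> 0"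
    using Q_weight_pos[of k] by simp
  then show "0 \<le> poly (Q_cofactor k) 0 * Q_weight k * poly (Q_cofactor k) 0"
    by (simp add: power2_eq_square mult_ac)
qed (use assms in auto)

lemma degree_kernel_poly_le: "degree (kernel_poly n) \<le> n - 2"
  unfolding kernel_poly_def
  by (rule degree_sum_le) (auto simp: degree_Q_cofactor)

text \<open>Only the term of index n reaches degree n - 2, and its factor R_n(0) is nonzero for even
  n. For odd n that term vanishes and the degree drops.\<close>

lemma degree_kernel_poly:
  assumes "n \<ge> 2" "even n"
  shows "degree (kernel_poly n) = n - 2"
proof -
  have "coeff (kernel_poly n) (n - 2) =
      (\<Sum>k=2..n. poly (Q_cofactor k) 0 * Q_weight k * coeff (Q_cofactor k) (n - 2))"
    by (simp add: kernel_poly_def coeff_sum)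
  also have "\<dots> = (\<Sum>k\<in>{n}. poly (Q_cofactor k) 0 * Q_weight k * coeff (Q_cofactor k) (n - 2))"
    using assms by (intro sum.mono_neutral_right) (auto simp: degree_Q_cofactor intro!: coeff_eq_0)
  also have "\<dots> \<noteq> 0"
    using assms Q_cofactor_at_0_nz[of n] Q_weight_pos[of n] Q_cofactor_nz[of n]
      leading_coeff_0_iff[of "Q_cofactor n"] by (simp add: degree_Q_cofactor)
  finally show ?thesis using degree_kernel_poly_le[of n] by (intro le_antisym le_degree)
qed

section \<open>The weighted integral\<close>

lemma weighted_integral_eq_wip: "weighted_integral ([:1, 0, -1:] * A) = ennreal (wip A A)"
proof -
  let ?p = "[:1, 0, -1:] * A * A"
  \<comment> \<open>Also true at -1 and 1, where both sides are 0.\<close>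
  have eq: "(poly ([:1, 0, -1:] * A) x)\<^sup>2 / (1 - x\<^sup>2) = poly ?p x" for x
    by (cases "1 - x\<^sup>2 = 0") (simp_all add: power2_eq_square field_simps)
  have nn: "0 \<le> poly ?p x" if "x \<in> {-1..1}" for x
  proof -
    have "x\<^sup>2 \<le> 1" using that by (simp add: abs_square_le_1 abs_le_iff)
    then have "0 \<le> (poly ([:1, 0, -1:] * A) x)\<^sup>2 / (1 - x\<^sup>2)" by simp
    then show ?thesis by (simp only: eq)
  qed
  have "(poly ?p has_integral wip A A) {-1..1}"
    unfolding wip_def by (rule integrable_integral) (rule poly_integrable)
  then have "(\<integral>\<^sup>+x. ennreal (poly ?p x) * indicator {-1..1} x \<partial>lborel) = ennreal (wip A A)"
    using nn by (rule nn_integral_has_integral_lebesgue'[rotated])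
  then show ?thesis by (simp only: weighted_integral_def eq)
qed

text \<open>Near 1 the integrand is at least c / (2 (1 - x)), whose integral diverges
  logarithmically. A supposed finite value r is refuted by a subinterval contributing r + 1.\<close>

lemma weighted_integral_eq_top:
  assumes "poly F 1 \<noteq> 0"
  shows "weighted_integral F = top"
proof (rule ccontr)
  assume "weighted_integral F \<noteq> top"
  then obtain r where r: "r \<ge> 0" "weighted_integral F = ennreal r"
    by (cases "weighted_integral F") auto
  define c where "c = (poly F 1)\<^sup>2 / 2"
  have c: "c > 0" using assms by (simp add: c_def)
  have "isCont (\<lambda>x. (poly F x)\<^sup>2) 1" by (intro continuous_intros)
  moreover have "c < (poly F 1)\<^sup>2" using assms by (simp add: c_def)
  ultimately have "\<forall>\<^sub>F x in at 1. c < (poly F x)\<^sup>2"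
    by (auto simp: isCont_def intro: order_tendstoD(1))
  then obtain d where d: "d > 0" "\<And>x. x \<noteq> 1 \<Longrightarrow> dist x 1 < d \<Longrightarrow> c < (poly F x)\<^sup>2"
    by (auto simp: eventually_at)
  \<comment> \<open>b < d keeps the lower bound on F^2 valid, and b <= 1 keeps x
    nonnegative.\<close>
  define b where "b = min (d / 2) 1"
  have b: "b > 0" "b < d" "b \<le> 1" using d(1) by (auto simp: b_def)
  \<comment> \<open>Chosen so that (c / 2) ln (b / e) = r + 1.\<close>
  define e where "e = b * exp (- (2 * (r + 1) / c))"
  have e: "e > 0" "e \<le> b" using b c r by (simp_all add: e_def mult_le_cancel_left1)
  have "((\<lambda>x. c / (2 * (1 - x))) has_integral
      (- (c / 2) * ln (1 - (1 - e)) - - (c / 2) * ln (1 - (1 - b)))) {1 - b..1 - e}"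
  proof (rule fundamental_theorem_of_calculus)
    fix x assume "x \<in> {1 - b..1 - e}"
    then have "x < 1" using e by auto
    then show "((\<lambda>x. - (c / 2) * ln (1 - x)) has_vector_derivative c / (2 * (1 - x)))
        (at x within {1 - b..1 - e})"
      unfolding has_real_derivative_iff_has_vector_derivative[symmetric]
      by (auto intro!: derivative_eq_intros simp: field_simps)
  qed (use e in simp)
  moreover have "- (c / 2) * ln (1 - (1 - e)) - - (c / 2) * ln (1 - (1 - b)) = r + 1"
    using b c by (simp add: e_def ln_mult field_simps)
  ultimately have "((\<lambda>x. c / (2 * (1 - x))) has_integral (r + 1)) {1 - b..1 - e}" by simp
  then have "ennreal (r + 1) =
      (\<integral>\<^sup>+x. ennreal (c / (2 * (1 - x))) * indicator {1 - b..1 - e} x \<partial>lborel)"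
    using c e by (intro nn_integral_has_integral_lebesgue'[symmetric]) auto
  also have "\<dots> \<le> weighted_integral F"
    unfolding weighted_integral_def
  proof (rule nn_integral_mono)
    fix x :: real
    show "ennreal (c / (2 * (1 - x))) * indicator {1 - b..1 - e} x
        \<le> ennreal ((poly F x)\<^sup>2 / (1 - x\<^sup>2)) * indicator {-1..1} x"
    proof (cases "x \<in> {1 - b..1 - e}")
      case True
      then have x: "0 \<le> x" "x < 1" "dist x 1 < d" using b e by (auto simp: dist_real_def)
      have "1 - x\<^sup>2 = (1 + x) * (1 - x)" by (simp add: power2_eq_square algebra_simps)
      moreover have "(1 + x) * (1 - x) \<le> 2 * (1 - x)"
        using x by (intro mult_right_mono) auto
      ultimately have "0 < 1 - x\<^sup>2" "1 - x\<^sup>2 \<le> 2 * (1 - x)"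
        using x by simp_all
      then have "c / (2 * (1 - x)) \<le> (poly F x)\<^sup>2 / (1 - x\<^sup>2)"
        using d(2)[of x] x c by (intro frac_le) auto
      then show ?thesis using True x by (simp add: ennreal_leI)
    qed simp
  qed
  finally show False using r by simp
qed

text \<open>Transfers the divergence criterion from the endpoint 1 to -1.\<close>

lemma weighted_integral_reflect: "weighted_integral (F \<circ>\<^sub>p [:0, -1:]) = weighted_integral F"
proof -
  have "weighted_integral F =
      (\<integral>\<^sup>+x. ennreal ((poly F (0 + (-1) * x))\<^sup>2 / (1 - (0 + (-1) * x)\<^sup>2)) * indicator {-1..1} (0 + (-1) * x) \<partial>lborel)"
    unfolding weighted_integral_def
  proof (subst nn_integral_real_affine[of _ "-1" 0])
    have [measurable]: "poly F \<in> borel_measurable borel"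
      by (intro borel_measurable_continuous_onI continuous_intros)
    show "(\<lambda>x. ennreal ((poly F x)\<^sup>2 / (1 - x\<^sup>2)) * indicator {-1..1} x) \<in> borel_measurable borel"
      by measurable
  qed simp_all
  also have "\<dots> = weighted_integral (F \<circ>\<^sub>p [:0, -1:])"
    unfolding weighted_integral_def
    by (intro nn_integral_cong) (auto simp: poly_pcompose indicator_def)
  finally show ?thesis by simp
qed

lemma weighted_integral_finite_imp_dvd:
  assumes "weighted_integral F \<noteq> top"
  obtains A where "F = [:1, 0, -1:] * A"
proof -
  have "poly F 1 = 0" using weighted_integral_eq_top assms by blast
  then obtain G where G: "F = [:-1, 1:] * G" by (auto simp: poly_eq_0_iff_dvd elim: dvdE)
  have "poly (F \<circ>\<^sub>p [:0, -1:]) 1 = 0"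
    using weighted_integral_eq_top weighted_integral_reflect assms by metis
  then have "poly G (-1) = 0" by (simp add: poly_pcompose G)
  then obtain H where "G = [:1, 1:] * H" by (auto simp: poly_eq_0_iff_dvd elim: dvdE)
  then have "F = [:1, 0, -1:] * (- H)" by (simp add: G flip: mult.assoc)
  then show ?thesis by (rule that)
qed

section \<open>The extremal problem\<close>

theorem theorem3:
  fixes n :: nat
  assumes "n \<ge> 2"
  shows "(\<exists>F. is_arg_min weighted_integral (admissible n) F \<and> (even n \<longrightarrow> degree F = n))
    \<and> (\<forall>F. is_arg_min weighted_integral (admissible n) F \<longrightarrow>
          weighted_integral F = ennreal (1 / dfact_sum n))
    \<and> (\<forall>F. admissible n F \<longrightarrow>
          (is_arg_min weighted_integral (admissible n) F \<longleftrightarrow>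
            (\<forall>x\<in>{-1..1}. poly F x = extremal n x)))
    \<and> 1 / dfact_sum n = 1 / Q_kernel n 0 0
    \<and> (\<forall>x\<in>{-1..1}. extremal n x = Q_kernel n x 0 / Q_kernel n 0 0)"
proof -
  define \<kappa> where "\<kappa> = poly (kernel_poly n) 0"
  define A\<^sub>0 where "A\<^sub>0 = smult (1 / \<kappa>) (kernel_poly n)"
  define F\<^sub>0 where "F\<^sub>0 = [:1, 0, -1:] * A\<^sub>0"
  have \<kappa>: "\<kappa> > 0" using kernel_poly_at_0_pos[OF assms] by (simp add: \<kappa>_def)
  have A0: "poly A\<^sub>0 0 = 1" "degree A\<^sub>0 \<le> n - 2" "A\<^sub>0 \<noteq> 0" "degree A\<^sub>0 = degree (kernel_poly n)"
    using \<kappa> degree_kernel_poly_le[of n] by (auto simp: A\<^sub>0_def \<kappa>_def)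
  have wip_A0: "wip A A\<^sub>0 = poly A 0 / \<kappa>" if "degree A \<le> n - 2" for A
    using kernel_poly_reproducing[OF assms that] by (simp add: A\<^sub>0_def wip_smult_right)
  have degree_mult: "degree ([:1, 0, -1:] * A) = degree A + 2" if "A \<noteq> 0" for A :: "real poly"
    using that by (subst degree_mult_eq) auto
  have F0: "admissible n F\<^sub>0"
    using A0 assms degree_mult[of A\<^sub>0] by (simp add: admissible_def F\<^sub>0_def)
  have wF0: "weighted_integral F\<^sub>0 = ennreal (1 / \<kappa>)"
    using A0 by (simp only: F\<^sub>0_def weighted_integral_eq_wip wip_A0)
  \<comment> \<open>Strictness against every other candidate yields minimality and uniqueness at
    once.\<close>
  have less: "weighted_integral F\<^sub>0 < weighted_integral F" if F: "admissible n F" "F \<noteq> F\<^sub>0" for F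
  proof (cases "weighted_integral F = top")
    case True then show ?thesis by (simp add: wF0)
  next
    case False
    then obtain A where A: "F = [:1, 0, -1:] * A" by (rule weighted_integral_finite_imp_dvd)
    have "A \<noteq> A\<^sub>0" using F A by (auto simp: F\<^sub>0_def)
    then have pos: "wip (A - A\<^sub>0) (A - A\<^sub>0) > 0" by (intro wip_self_pos) simp
    have A1: "poly A 0 = 1" using F by (simp add: admissible_def A)
    then have "A \<noteq> 0" by auto
    then have "degree A + 2 \<le> n"
      using F(1) degree_mult[of A] unfolding admissible_def A by simp
    then have "degree A \<le> n - 2" by simp
    then have "wip A A\<^sub>0 = 1 / \<kappa>" using wip_A0 A1 by simp
    \<comment> \<open>Expanding the square gives 0 < \<open>wip A A\<close> - 2/\<kappa> +
      1/\<kappa>.\<close>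
    then have "wip A A > 1 / \<kappa>"
      using pos wip_A0[OF A0(2)] A0(1)
      by (simp add: wip_diff_left wip_diff_right wip_commute[of A\<^sub>0 A])
    then show ?thesis using \<kappa> by (simp add: wF0 A weighted_integral_eq_wip ennreal_less_iff del: mult_pCons_left)
  qed
  have arg_min: "is_arg_min weighted_integral (admissible n) F \<longleftrightarrow> F = F\<^sub>0" for F
    using F0 less unfolding is_arg_min_def by (metis less_asym)
  have poly_F0: "poly F\<^sub>0 x = extremal n x" if "x \<in> {-1..1}" for x
    using that \<kappa> by (simp add: F\<^sub>0_def A\<^sub>0_def extremal_eq \<kappa>_def power2_eq_square field_simps)
  \<comment> \<open>Agreement on [-1, 1] already determines a polynomial.\<close>
  have eq_iff: "F = F\<^sub>0 \<longleftrightarrow> (\<forall>x\<in>{-1..1}. poly F x = extremal n x)" for F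
    using poly_F0 poly_eqI_interval[of "-1" 1 F F\<^sub>0] by auto
  have "degree F\<^sub>0 = degree (kernel_poly n) + 2"
    by (simp only: F\<^sub>0_def degree_mult[OF A0(3)] A0(4))
  then have deg: "even n \<longrightarrow> degree F\<^sub>0 = n"
    using assms degree_kernel_poly[of n] by auto
  have dfact: "dfact_sum n = \<kappa>" and kernel: "Q_kernel n 0 0 = \<kappa>"
    using Q_kernel_eq[of 0 n] by (simp_all add: dfact_sum_eq \<kappa>_def)
  have ext: "\<forall>x\<in>{-1..1}. extremal n x = Q_kernel n x 0 / \<kappa>"
    by (simp add: extremal_eq Q_kernel_eq \<kappa>_def)
  show ?thesis
    unfolding arg_min dfact kernel eq_iff[symmetric] using wF0 deg ext by blast
qed

end
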